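(* Let $R=K[x_1,\dots,x_n]$ be a polynomial ring over a field $K$. (1) Let $J\subset R$ be a strongly stable ideal. Then the ideal $I=\bigcap_{\sigma\in\mathfrak S_n}\sigma(J)$ is symmetric strongly shifted, with $P(I)=\{\lambda\in P_n: x^\lambda\in J\}$. (2) Conversely, every symmetric strongly shifted ideal $I$ has the form $I=\bigcap_{\sigma\in\mathfrak S_n}\sigma(J)$ for some strongly stable ideal $J$. In detail, let $B=B(I)\subset P_n$ be the set of partition Borel generators of $I$. Then the ideal $J=\mathrm{Borel}(x^B)$ satisfies $I=\bigcap_{\sigma\in\mathfrak S_n}\sigma(J)$. Moreover, $J$ is the smallest strongly stable ideal with this property.
   Context: $\mathfrak S_n$ acts on $R$ by permuting variables. $P_n=\{\lambda\in\mathbb Z^n: 0\le\lambda_1\le\cdots\le\lambda_n\}$ is the set of partitions (written nondecreasingly), $x^\lambda=x_1^{\lambda_1}\cdots x_n^{\lambda_n}$, and $x^B=\{x^\lambda:\lambda\in B\}$ for $B\subseteq P_n$. For an $\mathfrak S_n$-fixed monomial ideal $I$ put $P(I)=\{\lambda\in P_n: x^\lambda\in I\}$. An $\mathfrak S_n$-fixed monomial ideal $I$ is symmetric strongly shifted if for every $\lambda\in P(I)$ and $1\le i<j\le n$ with $\lambda_i<\lambda_j$ one has $x^\lambda x_i/x_j\in I$. A monomial ideal $J$ is strongly stable if for every monomial $x^\alpha\in J$ and every $i<j$ with $\alpha_j\neq0$ one has $x^\alpha x_i/x_j\in J$. For a set $M$ of monomials, $\mathrm{Borel}(M)$ is the smallest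 strongly stable ideal containing $M$. For $B\subseteq P_n$, $\mathrm{Sss}(B)$ is the smallest symmetric strongly shifted ideal containing $x^B$. The set $B(I)$ of partition Borel generators of a symmetric strongly shifted ideal $I$ is the smallest $B\subseteq P_n$ with $I=\mathrm{Sss}(B)$. All ideals considered are proper. *)

theory Defs
  imports "HOL-Algebra.Ideal" "HOL-Library.Poly_Mapping" "HOL-Combinatorics.Permutations"
begin

text \<open>
  The polynomial ring \<open>R = K[x\<^sub>1,\<dots>,x\<^sub>n]\<close> over the field \<open>'k\<close>. A monomial \<open>x\<^sup>\<alpha>\<close> is
  represented by its exponent vector \<open>\<alpha> :: nat \<Rightarrow>\<^sub>0 nat\<close>, supported on \<open>{1..n}\<close>, and a
  polynomial by its finitely supported coefficient function on exponent vectors.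
\<close>

type_synonym 'k mpol = "(nat \<Rightarrow>\<^sub>0 nat) \<Rightarrow>\<^sub>0 'k"

definition exponents :: "nat \<Rightarrow> (nat \<Rightarrow>\<^sub>0 nat) set" where
  "exponents n = {\<alpha>. Poly_Mapping.keys \<alpha> \<subseteq> {1..n}}"

definition xpow :: "(nat \<Rightarrow>\<^sub>0 nat) \<Rightarrow> 'k::field mpol" where
  "xpow \<alpha> = Poly_Mapping.single \<alpha> 1"

definition polring :: "nat \<Rightarrow> 'k::field mpol ring" where
  "polring n = \<lparr>carrier = {p. Poly_Mapping.keys p \<subseteq> exponents n},
     monoid.mult = (*), one = 1, zero = 0, add = (+)\<rparr>"

lemma cring_polring: "cring (polring n :: 'k::field mpol ring)"
proof (rule cringI)
  show "abelian_group (polring n :: 'k mpol ring)"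
  proof (rule abelian_groupI)
    fix p q :: "'k mpol"
    assume "p \<in> carrier (polring n)" "q \<in> carrier (polring n)"
    then show "p \<oplus>\<^bsub>polring n\<^esub> q \<in> carrier (polring n)"
      using Poly_Mapping.keys_add[of p q] by (auto simp: polring_def)
  next
    fix p :: "'k mpol"
    assume "p \<in> carrier (polring n)"
    then show "\<exists>q\<in>carrier (polring n). q \<oplus>\<^bsub>polring n\<^esub> p = \<zero>\<^bsub>polring n\<^esub>"
      by (intro bexI[of _ "- p"]) (auto simp: polring_def)
  qed (auto simp: polring_def algebra_simps)
  show "comm_monoid (polring n :: 'k mpol ring)"
  proof (rule comm_monoidI)
    fix p q :: "'k mpol"
    assume p: "p \<in> carrier (polring n)" and q: "q \<in> carrier (polring n)"
    have "Poly_Mapping.keys (a + b) \<subseteq> {1..n}"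
      if "a \<in> Poly_Mapping.keys p" "b \<in> Poly_Mapping.keys q" for a b
    proof -
      have "Poly_Mapping.keys a \<subseteq> {1..n}" "Poly_Mapping.keys b \<subseteq> {1..n}"
        using that p q unfolding polring_def exponents_def by auto
      then show ?thesis
        using Poly_Mapping.keys_add[of a b] by blast
    qed
    then show "p \<otimes>\<^bsub>polring n\<^esub> q \<in> carrier (polring n)"
      using Poly_Mapping.keys_mult[of p q] by (fastforce simp: polring_def exponents_def)
  qed (auto simp: polring_def exponents_def algebra_simps)
qed (auto simp: polring_def algebra_simps)

definition monomial_ideal :: "nat \<Rightarrow> 'k::field mpol set \<Rightarrow> bool" where
  "monomial_ideal n I \<longleftrightarrow> (\<exists>A \<subseteq> exponents n. I = Idl\<^bsub>polring n\<^esub> (xpow ` A))"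

text \<open>
  The action of \<open>\<sigma>\<close> on \<open>R\<close>, \<open>x\<^sub>i \<mapsto> x\<^bsub>\<sigma> i\<^esub>\<close>: as the function \<open>map_key\<close> precomposes, the
  coefficient of \<open>\<sigma> p\<close> at \<open>\<beta>\<close> is the coefficient of \<open>p\<close> at \<open>\<beta> \<circ> \<sigma>\<close>.
\<close>

definition perm_act :: "(nat \<Rightarrow> nat) \<Rightarrow> 'k::field mpol \<Rightarrow> 'k mpol" where
  "perm_act \<sigma> p = Poly_Mapping.map_key (Poly_Mapping.map_key \<sigma>) p"

lemma perm_act_xpow:
  assumes "\<sigma> permutes {1..n}"
  shows "perm_act \<sigma> (xpow \<alpha>) = (xpow (Poly_Mapping.map_key (inv_into UNIV \<sigma>) \<alpha>) :: 'k::field mpol)"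
proof -
  have bij: "bij \<sigma>"
    using assms by (rule permutes_bij)
  then have inj: "inj \<sigma>" "inj (inv_into UNIV \<sigma>)"
    by (auto simp: bij_is_inj bij_imp_bij_inv)
  have l: "Poly_Mapping.map_key (inv_into UNIV \<sigma>) (Poly_Mapping.map_key \<sigma> \<beta>) = \<beta>"
    for \<beta> :: "nat \<Rightarrow>\<^sub>0 nat"
    using bij inj
    by (auto intro!: poly_mapping_eqI simp: map_key.rep_eq bij_is_surj surj_f_inv_f)
  have r: "Poly_Mapping.map_key \<sigma> (Poly_Mapping.map_key (inv_into UNIV \<sigma>) \<beta>) = \<beta>"
    for \<beta> :: "nat \<Rightarrow>\<^sub>0 nat"
    using bij inj by (auto intro!: poly_mapping_eqI simp: map_key.rep_eq)
  have "inj (Poly_Mapping.map_key \<sigma> :: (nat \<Rightarrow>\<^sub>0 nat) \<Rightarrow> _)"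
    using l by (rule inj_on_inverseI)
  from map_key_single[OF this, of "Poly_Mapping.map_key (inv_into UNIV \<sigma>) \<alpha>" "1::'k"]
  show ?thesis
    by (simp add: perm_act_def xpow_def r)
qed

lemma perm_act_var:
  assumes "\<sigma> permutes {1..n}"
  shows "perm_act \<sigma> (xpow (Poly_Mapping.single i 1))
    = (xpow (Poly_Mapping.single (\<sigma> i) 1) :: 'k::field mpol)"
proof -
  have "inv_into UNIV \<sigma> (\<sigma> i) = i" "inj (inv_into UNIV \<sigma>)"
    using permutes_bij[OF assms] by (auto simp: bij_is_inj bij_imp_bij_inv)
  then have "Poly_Mapping.map_key (inv_into UNIV \<sigma>) (Poly_Mapping.single i (1::nat))
      = Poly_Mapping.single (\<sigma> i) 1"
    using map_key_single[of "inv_into UNIV \<sigma>" "\<sigma> i" "1::nat"] by simp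
  then show ?thesis
    by (simp add: perm_act_xpow[OF assms])
qed

definition sym_fixed :: "nat \<Rightarrow> 'k::field mpol set \<Rightarrow> bool" where
  "sym_fixed n I \<longleftrightarrow> (\<forall>\<sigma>. \<sigma> permutes {1..n} \<longrightarrow> perm_act \<sigma> ` I = I)"

definition sym_inter :: "nat \<Rightarrow> 'k::field mpol set \<Rightarrow> 'k mpol set" where
  "sym_inter n J = (\<Inter>\<sigma>\<in>{\<sigma>. \<sigma> permutes {1..n}}. perm_act \<sigma> ` J)"

text \<open>The set \<open>P\<^sub>n\<close>; partitions are written nondecreasingly.\<close>

definition partitions :: "nat \<Rightarrow> (nat \<Rightarrow>\<^sub>0 nat) set" where
  "partitions n = {l \<in> exponents n. \<forall>i j. 1 \<le> i \<and> i < j \<and> j \<le> n \<longrightarrow>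
     Poly_Mapping.lookup l i \<le> Poly_Mapping.lookup l j}"

definition parts :: "nat \<Rightarrow> 'k::field mpol set \<Rightarrow> (nat \<Rightarrow>\<^sub>0 nat) set" where
  "parts n I = {l \<in> partitions n. xpow l \<in> I}"

text \<open>
  The exponent vector of \<open>x\<^sup>\<alpha> x\<^sub>i / x\<^sub>j\<close>. The subtraction is truncated, so this is only
  meaningful for \<open>\<alpha>\<^sub>j > 0\<close>, which holds wherever it is used below.
\<close>

definition shift :: "(nat \<Rightarrow>\<^sub>0 nat) \<Rightarrow> nat \<Rightarrow> nat \<Rightarrow> (nat \<Rightarrow>\<^sub>0 nat)" where
  "shift \<alpha> i j = \<alpha> + Poly_Mapping.single i 1 - Poly_Mapping.single j 1"

text \<open>
  The unit ideal satisfies the next two predicates, so that \<open>Borel\<close> and \<open>Sss\<close> below are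
  defined for every generating set; properness is always required separately.
\<close>

definition sym_strongly_shifted :: "nat \<Rightarrow> 'k::field mpol set \<Rightarrow> bool" where
  "sym_strongly_shifted n I \<longleftrightarrow> monomial_ideal n I \<and> sym_fixed n I \<and>
     (\<forall>l \<in> parts n I. \<forall>i j. 1 \<le> i \<and> i < j \<and> j \<le> n \<and>
        Poly_Mapping.lookup l i < Poly_Mapping.lookup l j \<longrightarrow> xpow (shift l i j) \<in> I)"

definition strongly_stable :: "nat \<Rightarrow> 'k::field mpol set \<Rightarrow> bool" where
  "strongly_stable n J \<longleftrightarrow> monomial_ideal n J \<and>
     (\<forall>\<alpha> \<in> exponents n. xpow \<alpha> \<in> J \<longrightarrow> (\<forall>i j. 1 \<le> i \<and> i < j \<and> j \<le> n \<and>
        Poly_Mapping.lookup \<alpha> j \<noteq> 0 \<longrightarrow> xpow (shift \<alpha> i j) \<in> J))"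

definition proper_ideal :: "nat \<Rightarrow> 'k::field mpol set \<Rightarrow> bool" where
  "proper_ideal n I \<longleftrightarrow> ideal I (polring n) \<and> I \<noteq> carrier (polring n)"

definition Borel :: "nat \<Rightarrow> 'k::field mpol set \<Rightarrow> 'k mpol set" where
  "Borel n M = (LEAST J. strongly_stable n J \<and> M \<subseteq> J)"

definition Sss :: "nat \<Rightarrow> (nat \<Rightarrow>\<^sub>0 nat) set \<Rightarrow> 'k::field mpol set" where
  "Sss n B = (LEAST I. sym_strongly_shifted n I \<and> xpow ` B \<subseteq> I)"

definition borel_gens :: "nat \<Rightarrow> 'k::field mpol set \<Rightarrow> (nat \<Rightarrow>\<^sub>0 nat) set" where
  "borel_gens n I = (LEAST B. B \<subseteq> partitions n \<and> I = Sss n B)"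

end

theory Submission
  imports Defs
begin

text \<open>
  Order the exponent vectors of length \<open>n\<close> by componentwise comparison of their prefix sums
  (\<open>psum_le\<close>). A strongly stable ideal is the same as an up-set of this order: a vector below
  another one can be raised to it by moves \<open>x\<^sub>i\<close> and \<open>x\<^sub>i / x\<^sub>j\<close> with \<open>i < j\<close>. Between two
  partitions the moves can be chosen to stay inside the partitions (a Robin Hood transfer as in
  Muirhead's theorem), so a symmetric strongly shifted ideal is the same as an up-set of the
  order on partitions. A nondecreasing vector is the least of its rearrangements, and this
  makes \<open>J \<mapsto> \<Inter>\<sigma>(J)\<close> the restriction of up-sets to the partitions. The order is well-founded,
  hence the minimal elements of an up-set generate it, and they are the partition Borel generators.
\<close>


section \<open>Monomial ideals as sets of exponent vectors\<close>

abbreviation lk :: "('a \<Rightarrow>\<^sub>0 'b::zero) \<Rightarrow> 'a \<Rightarrow> 'b" where "lk \<equiv> Poly_Mapping.lookup"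
abbreviation sg :: "'a \<Rightarrow> 'b \<Rightarrow> ('a \<Rightarrow>\<^sub>0 'b::zero)" where "sg \<equiv> Poly_Mapping.single"
abbreviation permute_exp :: "(nat \<Rightarrow> nat) \<Rightarrow> (nat \<Rightarrow>\<^sub>0 nat) \<Rightarrow> (nat \<Rightarrow>\<^sub>0 nat)"
  where "permute_exp \<equiv> Poly_Mapping.map_key"

text \<open>A monomial ideal is the span of its monomials, so it is coded by the set of their
  exponents. This coding turns statements about ideals into statements about sets of
  vectors.\<close>

definition mspan :: "(nat \<Rightarrow>\<^sub>0 nat) set \<Rightarrow> 'k::field mpol set" where
  "mspan S = {p. Poly_Mapping.keys p \<subseteq> S}"

text \<open>The up-sets of divisibility, which are the codes of the monomial ideals.\<close>

definition mult_closed :: "nat \<Rightarrow> (nat \<Rightarrow>\<^sub>0 nat) set \<Rightarrow> bool" where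
  "mult_closed n S \<longleftrightarrow> S \<subseteq> exponents n \<and> (\<forall>a\<in>S. \<forall>d\<in>exponents n. a + d \<in> S)"

lemma lookup_exponents:
  "\<alpha> \<in> exponents n \<longleftrightarrow> (\<forall>i. i \<notin> {1..n} \<longrightarrow> lk \<alpha> i = 0)"
  by (auto simp: exponents_def in_keys_iff subset_iff)

lemma exponents_add: "\<alpha> \<in> exponents n \<Longrightarrow> \<beta> \<in> exponents n \<Longrightarrow> \<alpha> + \<beta> \<in> exponents n"
  by (auto simp: lookup_exponents lookup_add)

lemma exponents_zero [simp]: "0 \<in> exponents n"
  by (simp add: lookup_exponents)

lemma exponents_single: "i \<in> {1..n} \<Longrightarrow> sg i c \<in> exponents n"
  by (auto simp: lookup_exponents lookup_single when_def)

lemma lookup_shift: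
  assumes "i \<noteq> j"
  shows "lk (shift \<alpha> i j) m =
    (if m = i then lk \<alpha> m + 1 else if m = j then lk \<alpha> m - 1 else lk \<alpha> m)"
  using assms by (simp add: shift_def lookup_minus lookup_add lookup_single when_def)

lemma exponents_shift:
  assumes "\<alpha> \<in> exponents n" "i \<noteq> j" "i \<in> {1..n}"
  shows "shift \<alpha> i j \<in> exponents n"
  using assms by (auto simp: lookup_exponents lookup_shift)

lemma xpow_mspan [simp]: "(xpow \<alpha> :: 'k::field mpol) \<in> mspan S \<longleftrightarrow> \<alpha> \<in> S"
  by (simp add: mspan_def xpow_def)

lemma mspan_subset_iff [simp]: "(mspan S :: 'k::field mpol set) \<subseteq> mspan T \<longleftrightarrow> S \<subseteq> T"
proof
  assume "(mspan S :: 'k mpol set) \<subseteq> mspan T"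
  then show "S \<subseteq> T" using xpow_mspan[where 'k='k] by blast
qed (auto simp: mspan_def)

lemma mspan_eq_iff [simp]: "(mspan S :: 'k::field mpol set) = mspan T \<longleftrightarrow> S = T"
  by (simp add: set_eq_subset)

lemma carrier_polring: "carrier (polring n) = mspan (exponents n)"
  by (simp add: polring_def mspan_def)

lemma mult_closed_ideal:
  assumes "mult_closed n S"
  shows "ideal (mspan S :: 'k::field mpol set) (polring n)"
proof -
  interpret cring "polring n :: 'k mpol ring" by (rule cring_polring)
  have S: "S \<subseteq> exponents n" using assms by (simp add: mult_closed_def)
  have mult: "p * q \<in> mspan S" if "p \<in> mspan S" "q \<in> mspan (exponents n)" for p q :: "'k mpol"
  proof -
    have "a + b \<in> S" if "a \<in> Poly_Mapping.keys p" "b \<in> Poly_Mapping.keys q" for a b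
    proof -
      have "a \<in> S" "b \<in> exponents n"
        using that \<open>p \<in> mspan S\<close> \<open>q \<in> mspan (exponents n)\<close> by (auto simp: mspan_def)
      then show ?thesis using assms by (simp add: mult_closed_def)
    qed
    then show ?thesis using keys_mult[of p q] by (fastforce simp: mspan_def)
  qed
  have sub: "subgroup (mspan S) (add_monoid (polring n :: 'k mpol ring))"
  proof (rule add.subgroupI)
    show "(mspan S :: 'k mpol set) \<subseteq> carrier (polring n)"
      using S by (simp add: carrier_polring)
    have "(0 :: 'k mpol) \<in> mspan S" by (simp add: mspan_def)
    then show "(mspan S :: 'k mpol set) \<noteq> {}" by blast
  next
    fix a :: "'k mpol" assume a: "a \<in> mspan S"
    then have m: "- a \<in> mspan S" by (simp add: mspan_def)
    \<comment> \<open>The ring \<open>polring n\<close> defines its inverse only through its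
      addition, so uniqueness of inverses identifies it with the negation of the type.\<close>
    have "\<ominus>\<^bsub>polring n\<^esub> a = - a"
    proof (rule minus_equality)
      show "a \<in> carrier (polring n)" "- a \<in> carrier (polring n)"
        using a m S by (auto simp: carrier_polring mspan_def)
    qed (simp add: polring_def)
    then show "\<ominus>\<^bsub>polring n\<^esub> a \<in> mspan S" using m by simp
  next
    fix a b :: "'k mpol" assume "a \<in> mspan S" "b \<in> mspan S"
    then show "a \<oplus>\<^bsub>polring n\<^esub> b \<in> mspan S"
      using keys_add[of a b] by (auto simp: mspan_def polring_def)
  qed
  show ?thesis
  proof (rule idealI)
    show "ring (polring n :: 'k mpol ring)" ..
    fix a x :: "'k mpol"
    assume "a \<in> mspan S" "x \<in> carrier (polring n)"
    then show "x \<otimes>\<^bsub>polring n\<^esub> a \<in> mspan S" "a \<otimes>\<^bsub>polring n\<^esub> x \<in> mspan S"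
      using mult[of a x] by (simp_all add: carrier_polring mult.commute)
        (simp_all add: polring_def mult.commute)
  qed (use sub in simp)
qed

lemma poly_mapping_sum_monomials: "(\<Sum>\<alpha>\<in>Poly_Mapping.keys p. sg \<alpha> (lk p \<alpha>)) = p"
proof (rule poly_mapping_eqI)
  fix \<beta>
  show "lk (\<Sum>\<alpha>\<in>Poly_Mapping.keys p. sg \<alpha> (lk p \<alpha>)) \<beta> = lk p \<beta>"
    by (simp add: lookup_sum lookup_single when_def in_keys_iff)
qed

text \<open>A polynomial is the finite sum of its terms. The coefficient is put into the assumption
  so that an induction over finite sums of terms suffices.\<close>

lemma mspan_least:
  assumes I: "ideal I (polring n)"
    and S: "\<And>\<alpha> c. \<alpha> \<in> S \<Longrightarrow> sg \<alpha> c \<in> I"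
  shows "(mspan S :: 'k::field mpol set) \<subseteq> I"
proof
  fix p :: "'k mpol" assume p: "p \<in> mspan S"
  interpret ideal I "polring n :: 'k mpol ring" by (rule I)
  have "(\<Sum>\<alpha>\<in>F. sg \<alpha> (lk p \<alpha>)) \<in> I" if "finite F" "F \<subseteq> S" for F
    using that
  proof (induction F)
    case empty
    then show ?case
      using additive_subgroup.zero_closed[OF additive_subgroup_axioms] by (simp add: polring_def)
  next
    case (insert x F)
    then show ?case
      using additive_subgroup.a_closed[OF additive_subgroup_axioms,
          of "sg x (lk p x)" "\<Sum>\<alpha>\<in>F. sg \<alpha> (lk p \<alpha>)"] S
      by (simp add: polring_def)
  qed
  from this[of "Poly_Mapping.keys p"] p show "p \<in> I"
    by (simp add: mspan_def poly_mapping_sum_monomials)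
qed

lemma mult_closed_generated:
  assumes "A \<subseteq> exponents n"
  shows "mult_closed n {a + d | a d. a \<in> A \<and> d \<in> exponents n}"
  unfolding mult_closed_def
proof (intro conjI ballI subsetI)
  fix x e assume "x \<in> {a + d | a d. a \<in> A \<and> d \<in> exponents n}" "e \<in> exponents n"
  then obtain a d where "x = a + d" "a \<in> A" "d \<in> exponents n" by blast
  then have "x + e = a + (d + e)" "d + e \<in> exponents n"
    using \<open>e \<in> exponents n\<close> by (simp_all add: add.assoc exponents_add)
  then show "x + e \<in> {a + d | a d. a \<in> A \<and> d \<in> exponents n}" using \<open>a \<in> A\<close> by blast
qed (use assms in \<open>auto intro: exponents_add\<close>)

text \<open>The multiples of the generators span an ideal, which bounds the generated ideal from
  above. Conversely, each term with such an exponent is a generator times a term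
  \<open>sg d c\<close>.\<close>

lemma genideal_xpow:
  assumes "A \<subseteq> exponents n"
  shows "Idl\<^bsub>polring n\<^esub> (xpow ` A) = (mspan {a + d | a d. a \<in> A \<and> d \<in> exponents n} :: 'k::field mpol set)"
    (is "_ = mspan ?S")
proof
  interpret cring "polring n :: 'k mpol ring" by (rule cring_polring)
  have mc: "mult_closed n ?S"
    using assms by (rule mult_closed_generated)
  have "A \<subseteq> ?S" by (force intro: exI[of _ "0::nat \<Rightarrow>\<^sub>0 nat"])
  then have "xpow ` A \<subseteq> (mspan ?S :: 'k mpol set)" by auto
  then show "Idl\<^bsub>polring n\<^esub> (xpow ` A) \<subseteq> (mspan ?S :: 'k mpol set)"
    by (rule genideal_minimal[OF mult_closed_ideal[OF mc]])
  have A: "xpow ` A \<subseteq> carrier (polring n :: 'k mpol ring)"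
    using assms by (auto simp: carrier_polring)
  interpret I: ideal "Idl\<^bsub>polring n\<^esub> (xpow ` A)" "polring n :: 'k mpol ring"
    by (rule genideal_ideal[OF A])
  show "(mspan ?S :: 'k mpol set) \<subseteq> Idl\<^bsub>polring n\<^esub> (xpow ` A)"
  proof (rule mspan_least)
    show "ideal (Idl\<^bsub>polring n\<^esub> (xpow ` A)) (polring n :: 'k mpol ring)" ..
    fix \<alpha> and c :: 'k assume "\<alpha> \<in> ?S"
    then obtain a d where ad: "\<alpha> = a + d" "a \<in> A" "d \<in> exponents n" by blast
    have "sg d c \<in> carrier (polring n)"
      using ad by (simp add: carrier_polring mspan_def)
    moreover have "(xpow a :: 'k mpol) \<in> Idl\<^bsub>polring n\<^esub> (xpow ` A)"
      using ad(2) by (intro subsetD[OF genideal_self[OF A]] imageI)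
    ultimately have "(xpow a :: 'k mpol) \<otimes>\<^bsub>polring n\<^esub> sg d c \<in> Idl\<^bsub>polring n\<^esub> (xpow ` A)"
      by (rule I.I_r_closed[rotated])
    then show "sg \<alpha> c \<in> Idl\<^bsub>polring n\<^esub> (xpow ` A)"
      by (simp add: ad xpow_def polring_def mult_single)
  qed
qed

text \<open>For the converse, \<open>S\<close> serves as its own set of generating exponents,
  because the multiplier \<open>0\<close> is allowed.\<close>

lemma monomial_ideal_iff:
  "monomial_ideal n (I :: 'k::field mpol set) \<longleftrightarrow> (\<exists>S. mult_closed n S \<and> I = mspan S)"
proof
  assume "monomial_ideal n I"
  then obtain A where A: "A \<subseteq> exponents n" "I = Idl\<^bsub>polring n\<^esub> (xpow ` A)"
    by (auto simp: monomial_ideal_def)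
  have "mult_closed n {a + d | a d. a \<in> A \<and> d \<in> exponents n}"
    using A(1) by (rule mult_closed_generated)
  then show "\<exists>S. mult_closed n S \<and> I = mspan S"
    using A genideal_xpow by blast
next
  assume "\<exists>S. mult_closed n S \<and> I = mspan S"
  then obtain S where S: "mult_closed n S" "I = mspan S" by blast
  have "{a + d | a d. a \<in> S \<and> d \<in> exponents n} = S"
    using S by (auto simp: mult_closed_def) (metis add.right_neutral exponents_zero)
  then show "monomial_ideal n I"
    using S genideal_xpow[of S n, where 'k='k] by (auto simp: monomial_ideal_def mult_closed_def)
qed

lemma monomial_ideal_mspan [simp]:
  "monomial_ideal n (mspan S :: 'k::field mpol set) \<longleftrightarrow> mult_closed n S"
  by (auto simp: monomial_ideal_iff)

text \<open>The vector \<open>0\<close> is the exponent of the unit monomial, and closure spreads it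
  to all of \<open>exponents n\<close>.\<close>

lemma proper_ideal_mspan:
  assumes "mult_closed n S"
  shows "proper_ideal n (mspan S :: 'k::field mpol set) \<longleftrightarrow> 0 \<notin> S"
proof -
  have "S = exponents n \<longleftrightarrow> 0 \<in> S"
    using assms by (force simp: mult_closed_def)
  then show ?thesis
    by (simp add: proper_ideal_def mult_closed_ideal[OF assms] carrier_polring)
qed

section \<open>Permutations acting on exponent vectors and on spans of monomials\<close>

lemma lookup_permute_exp:
  "\<sigma> permutes {1..n} \<Longrightarrow> lk (permute_exp \<sigma> \<alpha>) i = lk \<alpha> (\<sigma> i)"
  by (simp add: map_key.rep_eq permutes_inj)

lemma permute_exp_in_exponents:
  assumes "\<sigma> permutes {1..n}" "\<alpha> \<in> exponents n"
  shows "permute_exp \<sigma> \<alpha> \<in> exponents n"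
  using assms by (simp add: lookup_exponents lookup_permute_exp permutes_not_in del: atLeastAtMost_iff)

text \<open>Precomposition reverses the order of the two permutations.\<close>

lemma permute_exp_comp:
  assumes "\<sigma> permutes {1..n}" "\<tau> permutes {1..n}"
  shows "permute_exp \<sigma> (permute_exp \<tau> \<alpha>) = permute_exp (\<tau> \<circ> \<sigma>) \<alpha>"
  using assms permutes_compose[OF assms]
  by (auto intro!: poly_mapping_eqI simp: lookup_permute_exp)

lemma permute_exp_inv:
  assumes "\<sigma> permutes {1..n}"
  shows "permute_exp \<sigma> (permute_exp (inv_into UNIV \<sigma>) \<alpha>) = \<alpha>"
    "permute_exp (inv_into UNIV \<sigma>) (permute_exp \<sigma> \<alpha>) = \<alpha>"
  using assms permutes_inv[OF assms]
  by (auto intro!: poly_mapping_eqI simp: lookup_permute_exp permutes_inverses)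

lemma permute_exp_id: "permute_exp id \<alpha> = \<alpha>"
  by (rule poly_mapping_eqI) (simp add: map_key.rep_eq)

lemma lookup_perm_act:
  assumes "\<sigma> permutes {1..n}"
  shows "lk (perm_act \<sigma> p) \<beta> = lk p (permute_exp \<sigma> \<beta>)"
proof -
  have "inj (permute_exp \<sigma>)"
    by (rule inj_on_inverseI[where g = "permute_exp (inv_into UNIV \<sigma>)"])
      (simp add: permute_exp_inv[OF assms])
  then show ?thesis by (simp add: perm_act_def map_key.rep_eq)
qed

lemma perm_act_mspan:
  assumes "\<sigma> permutes {1..n}"
  shows "perm_act \<sigma> ` mspan S = (mspan {\<beta>. permute_exp \<sigma> \<beta> \<in> S} :: 'k::field mpol set)"
proof
  show "perm_act \<sigma> ` mspan S \<subseteq> (mspan {\<beta>. permute_exp \<sigma> \<beta> \<in> S} :: 'k mpol set)"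
    by (auto simp: mspan_def subset_iff in_keys_iff lookup_perm_act[OF assms])
next
  have inv: "inv_into UNIV \<sigma> permutes {1..n}" using assms by (rule permutes_inv)
  show "(mspan {\<beta>. permute_exp \<sigma> \<beta> \<in> S} :: 'k mpol set) \<subseteq> perm_act \<sigma> ` mspan S"
  proof
    fix p :: "'k mpol" assume p: "p \<in> mspan {\<beta>. permute_exp \<sigma> \<beta> \<in> S}"
    have "p = perm_act \<sigma> (perm_act (inv_into UNIV \<sigma>) p)"
      by (rule poly_mapping_eqI)
        (simp add: lookup_perm_act[OF assms] lookup_perm_act[OF inv] permute_exp_inv[OF assms])
    moreover have "perm_act (inv_into UNIV \<sigma>) p \<in> mspan S"
    proof -
      have "\<beta> \<in> S" if "lk p (permute_exp (inv_into UNIV \<sigma>) \<beta>) \<noteq> 0" for \<beta>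
        using p that by (auto simp: mspan_def subset_iff in_keys_iff permute_exp_inv[OF assms] dest!: spec)
      then show ?thesis
        by (auto simp: mspan_def in_keys_iff lookup_perm_act[OF inv])
    qed
    ultimately show "p \<in> perm_act \<sigma> ` mspan S" by blast
  qed
qed

text \<open>The largest permutation-stable subset of \<open>S\<close>. If \<open>S\<close> codes
  \<open>J\<close>, it codes the intersection of all \<open>\<sigma>(J)\<close>.\<close>

definition sym_core :: "nat \<Rightarrow> (nat \<Rightarrow>\<^sub>0 nat) set \<Rightarrow> (nat \<Rightarrow>\<^sub>0 nat) set" where
  "sym_core n S = {\<alpha>. \<forall>\<sigma>. \<sigma> permutes {1..n} \<longrightarrow> permute_exp \<sigma> \<alpha> \<in> S}"

lemma sym_core_subset: "sym_core n S \<subseteq> S"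
proof
  fix \<alpha> assume "\<alpha> \<in> sym_core n S"
  then have "permute_exp id \<alpha> \<in> S" unfolding sym_core_def using permutes_id by blast
  then show "\<alpha> \<in> S" by (simp add: permute_exp_id)
qed

lemma sym_inter_mspan: "sym_inter n (mspan S) = (mspan (sym_core n S) :: 'k::field mpol set)"
proof -
  have "sym_inter n (mspan S) = (\<Inter>\<sigma>\<in>{\<sigma>. \<sigma> permutes {1..n}}. mspan {\<beta>. permute_exp \<sigma> \<beta> \<in> S} :: 'k mpol set)"
    unfolding sym_inter_def by (intro INF_cong refl) (simp add: perm_act_mspan)
  also have "\<dots> = mspan (sym_core n S)"
    by (auto simp: mspan_def sym_core_def)
  finally show ?thesis .
qed

text \<open>Stability under the inverse permutation upgrades the inclusion to the equality in
  \<open>sym_fixed\<close>.\<close>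

lemma sym_fixed_mspan:
  "sym_fixed n (mspan S :: 'k::field mpol set) \<longleftrightarrow>
    (\<forall>\<sigma>. \<sigma> permutes {1..n} \<longrightarrow> (\<forall>\<alpha>\<in>S. permute_exp \<sigma> \<alpha> \<in> S))"
proof -
  have "sym_fixed n (mspan S :: 'k mpol set) \<longleftrightarrow>
      (\<forall>\<sigma>. \<sigma> permutes {1..n} \<longrightarrow> {\<beta>. permute_exp \<sigma> \<beta> \<in> S} = S)"
    by (simp add: sym_fixed_def perm_act_mspan)
  also have "\<dots> \<longleftrightarrow> (\<forall>\<sigma>. \<sigma> permutes {1..n} \<longrightarrow> (\<forall>\<alpha>\<in>S. permute_exp \<sigma> \<alpha> \<in> S))"
    (is "?L \<longleftrightarrow> ?R")
  proof
    assume R: ?R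
    have "\<beta> \<in> S" if "\<sigma> permutes {1..n}" "permute_exp \<sigma> \<beta> \<in> S" for \<sigma> \<beta>
      using R that permutes_inv[OF that(1)] permute_exp_inv(2)[OF that(1)] by metis
    with R show ?L by blast
  qed blast
  finally show ?thesis .
qed

section \<open>The order by prefix sums\<close>

definition psum :: "(nat \<Rightarrow>\<^sub>0 nat) \<Rightarrow> nat \<Rightarrow> nat" where
  "psum \<alpha> k = (\<Sum>i=1..k. lk \<alpha> i)"

text \<open>On vectors of equal degree this is the dominance order of compositions. Different
  degrees may be compared, so multiplying by a variable also goes up.\<close>

definition psum_le :: "nat \<Rightarrow> (nat \<Rightarrow>\<^sub>0 nat) \<Rightarrow> (nat \<Rightarrow>\<^sub>0 nat) \<Rightarrow> bool" where
  "psum_le n \<alpha> \<beta> \<longleftrightarrow> (\<forall>k\<le>n. psum \<alpha> k \<le> psum \<beta> k)"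

text \<open>Below, up-sets are expressed as fixed points \<open>psum_upset n S = S\<close>, which
  includes \<open>S \<subseteq> exponents n\<close>.\<close>

definition psum_upset :: "nat \<Rightarrow> (nat \<Rightarrow>\<^sub>0 nat) set \<Rightarrow> (nat \<Rightarrow>\<^sub>0 nat) set" where
  "psum_upset n B = {\<alpha> \<in> exponents n. \<exists>\<beta>\<in>B. psum_le n \<beta> \<alpha>}"

lemma psum_0 [simp]: "psum \<alpha> 0 = 0"
  by (simp add: psum_def)

lemma psum_Suc [simp]: "psum \<alpha> (Suc k) = psum \<alpha> k + lk \<alpha> (Suc k)"
  by (simp add: psum_def)

lemma psum_add: "psum (\<alpha> + \<beta>) k = psum \<alpha> k + psum \<beta> k"
  by (simp add: psum_def lookup_add sum.distrib)

lemma psum_single: "i \<ge> 1 \<Longrightarrow> psum (sg i c) k = (if i \<le> k then c else 0)"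
  by (auto simp: psum_def lookup_single when_def)

text \<open>Moving the removed variable to the other side avoids truncated subtraction when entries
  of a shifted vector are summed.\<close>

lemma shift_add_single:
  assumes "i \<noteq> j" "lk \<alpha> j \<noteq> 0"
  shows "shift \<alpha> i j + sg j 1 = \<alpha> + sg i 1"
  using assms by (intro poly_mapping_eqI) (auto simp: lookup_add lookup_shift lookup_single when_def)

lemma psum_shift:
  assumes "1 \<le> i" "i < j" "lk \<alpha> j \<noteq> 0"
  shows "psum (shift \<alpha> i j) k = (if i \<le> k \<and> k < j then psum \<alpha> k + 1 else psum \<alpha> k)"
proof -
  have "shift \<alpha> i j + sg j 1 = \<alpha> + sg i 1"
    using assms by (intro shift_add_single) auto
  then have "psum (shift \<alpha> i j) k + psum (sg j 1) k = psum \<alpha> k + psum (sg i 1) k"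
    by (metis psum_add)
  then show ?thesis using assms by (auto simp: psum_single split: if_splits)
qed

lemma psum_le_refl [simp]: "psum_le n \<alpha> \<alpha>"
  by (simp add: psum_le_def)

lemma psum_le_trans: "psum_le n \<alpha> \<beta> \<Longrightarrow> psum_le n \<beta> \<gamma> \<Longrightarrow> psum_le n \<alpha> \<gamma>"
  unfolding psum_le_def using order_trans by blast

lemma psum_le_add: "psum_le n \<alpha> (\<alpha> + \<beta>)"
  by (simp add: psum_le_def psum_add)

lemma exponents_eqI:
  assumes "\<alpha> \<in> exponents n" "\<beta> \<in> exponents n" "\<And>k. k \<le> n \<Longrightarrow> psum \<alpha> k = psum \<beta> k"
  shows "\<alpha> = \<beta>"
proof (rule poly_mapping_eqI)
  fix i
  show "lk \<alpha> i = lk \<beta> i"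
  proof (cases "i \<in> {1..n}")
    case True
    then obtain m where m: "i = Suc m" by (cases i) auto
    then have "psum \<alpha> m = psum \<beta> m" "psum \<alpha> (Suc m) = psum \<beta> (Suc m)"
      using assms(3) True m by (auto simp del: psum_Suc)
    then show ?thesis by (simp add: m)
  qed (use assms in \<open>simp add: lookup_exponents\<close>)
qed

lemma psum_le_antisym:
  assumes "\<alpha> \<in> exponents n" "\<beta> \<in> exponents n" "psum_le n \<alpha> \<beta>" "psum_le n \<beta> \<alpha>"
  shows "\<alpha> = \<beta>"
  using assms by (intro exponents_eqI) (auto simp: psum_le_def intro: antisym)

text \<open>The total of the prefix sums is a strictly monotone rank in the natural numbers. It is
  the measure both for climbing to a given vector and for descending to a minimal one.\<close>

lemma psum_le_sum_less:
  assumes "\<alpha> \<in> exponents n" "\<beta> \<in> exponents n" "psum_le n \<alpha> \<beta>" "\<alpha> \<noteq> \<beta>"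
  shows "(\<Sum>k\<le>n. psum \<alpha> k) < (\<Sum>k\<le>n. psum \<beta> k)"
proof (rule sum_strict_mono_ex1)
  have "\<exists>k\<le>n. psum \<alpha> k \<noteq> psum \<beta> k"
    using assms exponents_eqI by blast
  then show "\<exists>k\<in>{..n}. psum \<alpha> k < psum \<beta> k"
    using assms(3) by (force simp: psum_le_def)
qed (use assms(3) in \<open>auto simp: psum_le_def\<close>)

section \<open>Connecting comparable vectors by elementary moves\<close>

lemma partitions_exponents: "\<kappa> \<in> partitions n \<Longrightarrow> \<kappa> \<in> exponents n"
  by (simp add: partitions_def)

lemma partitions_mono:
  assumes "\<kappa> \<in> partitions n" "1 \<le> i" "i \<le> j" "j \<le> n"
  shows "lk \<kappa> i \<le> lk \<kappa> j"
  using assms by (cases "i = j") (auto simp: partitions_def)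

text \<open>
  The position \<open>i\<close> is the last one with \<open>\<mu>\<^sub>i < \<kappa>\<^sub>i\<close> and \<open>j\<close> the first one after it with
  \<open>\<mu>\<^sub>j > \<kappa>\<^sub>j\<close>, if any. In between, \<open>\<mu>\<close> and \<open>\<kappa>\<close> agree, so all prefix sums that grow were
  strictly smaller, and the step keeps \<open>\<mu>\<close> sorted when \<open>\<kappa>\<close> is.
\<close>

lemma psum_le_step:
  assumes mu: "\<mu> \<in> exponents n" and la: "\<kappa> \<in> exponents n"
    and dom: "psum_le n \<mu> \<kappa>" and ne: "\<mu> \<noteq> \<kappa>"
  obtains (add) i where "i \<in> {1..n}" "psum_le n (\<mu> + sg i 1) \<kappa>"
      "\<kappa> \<in> partitions n \<Longrightarrow> \<mu> \<in> partitions n \<Longrightarrow> \<mu> + sg i 1 \<in> partitions n"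
  | (shift) i j where "1 \<le> i" "i < j" "j \<le> n" "lk \<mu> j \<noteq> 0" "psum_le n (shift \<mu> i j) \<kappa>"
      "\<kappa> \<in> partitions n \<Longrightarrow> lk \<mu> i < lk \<mu> j"
      "\<kappa> \<in> partitions n \<Longrightarrow> \<mu> \<in> partitions n \<Longrightarrow> shift \<mu> i j \<in> partitions n"
proof -
  define P where "P = {i \<in> {1..n}. lk \<mu> i < lk \<kappa> i}"
  have "P \<noteq> {}"
  proof
    assume "P = {}"
    then have "psum \<kappa> k \<le> psum \<mu> k" if "k \<le> n" for k
      unfolding psum_def P_def using that by (intro sum_mono) (auto simp: not_less)
    then have "psum_le n \<kappa> \<mu>" by (simp add: psum_le_def)
    then show False using psum_le_antisym[OF mu la dom] ne by blast
  qed
  moreover have "finite P" by (simp add: P_def)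
  ultimately have iP: "Max P \<in> P" and maxP: "\<And>m. m \<in> P \<Longrightarrow> m \<le> Max P" by auto
  define i where "i = Max P"
  have i: "1 \<le> i" "i \<le> n" "lk \<mu> i < lk \<kappa> i" using iP by (simp_all add: P_def i_def)
  have above: "lk \<kappa> m \<le> lk \<mu> m" if "i < m" "m \<le> n" for m
  proof (rule ccontr)
    assume "\<not> lk \<kappa> m \<le> lk \<mu> m"
    then have "m \<in> P" using that i by (simp add: P_def)
    then show False using maxP[of m] that by (simp add: i_def)
  qed
  have gap: "psum \<mu> m < psum \<kappa> m"
    if "i \<le> m" "m \<le> n" "\<And>l. i < l \<Longrightarrow> l \<le> m \<Longrightarrow> lk \<mu> l = lk \<kappa> l" for m
    using that
  proof (induction m rule: dec_induct)
    case base
    obtain i' where i': "i = Suc i'" using i by (cases i) auto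
    have "psum \<mu> i' \<le> psum \<kappa> i'" using dom i i' by (simp add: psum_le_def)
    then show ?case using i i' by simp
  next
    case (step m)
    then show ?case by simp
  qed
  define Q where "Q = {j \<in> {i<..n}. lk \<kappa> j < lk \<mu> j}"
  show thesis
  proof (cases "Q = {}")
    case True
    have eq: "lk \<mu> l = lk \<kappa> l" if "i < l" "l \<le> n" for l
      using True that above[OF that] by (auto simp: Q_def not_less)
    show thesis
    proof (rule add)
      show "i \<in> {1..n}" using i by simp
      have "psum (\<mu> + sg i 1) k \<le> psum \<kappa> k" if "k \<le> n" for k
        using gap[of k] eq dom that i by (auto simp: psum_add psum_single psum_le_def Suc_le_eq)
      then show "psum_le n (\<mu> + sg i 1) \<kappa>" by (simp add: psum_le_def)
      assume L: "\<kappa> \<in> partitions n" and M: "\<mu> \<in> partitions n"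
      have "lk (\<mu> + sg i 1) a \<le> lk (\<mu> + sg i 1) b" if "1 \<le> a" "a < b" "b \<le> n" for a b
      proof (cases "a = i")
        case True
        then have "lk \<mu> i < lk \<mu> b"
          using i partitions_mono[OF L, of i b] that eq[of b] by simp
        then show ?thesis using True that by (simp add: lookup_add lookup_single when_def)
      next
        case False
        then show ?thesis using partitions_mono[OF M, of a b] that
          by (simp add: lookup_add lookup_single when_def)
      qed
      then show "\<mu> + sg i 1 \<in> partitions n"
        using mu i by (auto simp: partitions_def intro!: exponents_add exponents_single)
    qed
  next
    case False
    moreover have "finite Q" by (simp add: Q_def)
    ultimately have jQ: "Min Q \<in> Q" and minQ: "\<And>m. m \<in> Q \<Longrightarrow> Min Q \<le> m" by auto
    define j where "j = Min Q"
    have j: "i < j" "j \<le> n" "lk \<kappa> j < lk \<mu> j" using jQ by (simp_all add: Q_def j_def)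
    have eq: "lk \<mu> l = lk \<kappa> l" if "i < l" "l < j" for l
    proof -
      have "l \<notin> Q" using minQ[of l] that by (auto simp: j_def)
      then show ?thesis using above[of l] that j by (simp add: Q_def)
    qed
    have ls: "lk (shift \<mu> i j) m =
        (if m = i then lk \<mu> m + 1 else if m = j then lk \<mu> m - 1 else lk \<mu> m)" for m
      using j by (intro lookup_shift) simp
    show thesis
    proof (rule shift)
      show "1 \<le> i" "i < j" "j \<le> n" "lk \<mu> j \<noteq> 0" using i j by auto
      have "psum (shift \<mu> i j) k \<le> psum \<kappa> k" if "k \<le> n" for k
        using gap[of k] eq dom that i j by (auto simp: psum_shift psum_le_def Suc_le_eq)
      then show "psum_le n (shift \<mu> i j) \<kappa>" by (simp add: psum_le_def)
    next
      assume L: "\<kappa> \<in> partitions n"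
      show lt: "lk \<mu> i < lk \<mu> j"
        using i j partitions_mono[OF L, of i j] by simp
      assume M: "\<mu> \<in> partitions n"
      have "lk (shift \<mu> i j) a \<le> lk (shift \<mu> i j) b" if ab: "1 \<le> a" "a < b" "b \<le> n" for a b
      proof -
        have lij: "lk \<kappa> i \<le> lk \<kappa> j" using i j partitions_mono[OF L, of i j] by simp
        have m: "lk \<mu> a \<le> lk \<mu> b" using partitions_mono[OF M, of a b] ab by simp
        have l: "lk \<kappa> a \<le> lk \<kappa> b" using partitions_mono[OF L, of a b] ab by simp
        \<comment> \<open>For \<open>a = i\<close>, \<open>b = j\<close> the chain is
          \<open>\<mu>\<^sub>i + 1 \<le> \<kappa>\<^sub>i \<le> \<kappa>\<^sub>j \<le> \<mu>\<^sub>j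
          - 1\<close>. A changed entry and one strictly between \<open>i\<close> and
          \<open>j\<close> are compared through \<open>\<kappa>\<close>, which agrees with
          \<open>\<mu>\<close> there. The other cases follow from \<open>\<mu>\<close> being sorted
          and \<open>\<mu>\<^sub>i < \<mu>\<^sub>j\<close>.\<close>
        consider "a = i" "b < j" | "a = i" "b = j" | "a = i" "j < b" | "a < i" | "a > i" "b = j"
          | "a > i" "b \<noteq> j" using ab by linarith
        then show ?thesis
        proof cases
          case 1
          then show ?thesis using ab i l eq[of b] by (simp add: ls)
        next
          case 2
          then show ?thesis using i j lij by (simp add: ls)
        next
          case 3
          then show ?thesis using lt j partitions_mono[OF M, of j b] ab by (simp add: ls)
        next
          case 4
          then show ?thesis using m lt j partitions_mono[OF M, of a i] i ab by (auto simp: ls)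
        next
          case 5
          then show ?thesis using l eq[of a] j ab by (simp add: ls)
        next
          case 6
          then show ?thesis using m j ab by (auto simp: ls)
        qed
      qed
      then show "shift \<mu> i j \<in> partitions n"
        using mu i j by (auto simp: partitions_def intro!: exponents_shift)
    qed
  qed
qed

text \<open>Repeated use of \<open>psum_le_step\<close> climbs from \<open>\<mu>\<close> to
  \<open>\<kappa>\<close> inside \<open>U\<close>. The guards
  \<open>\<kappa> \<in> partitions n\<close> let one induction serve two purposes: they are vacuous
  for a general \<open>\<kappa>\<close>, and for a partition \<open>\<kappa>\<close> they supply
  what a symmetric strongly shifted ideal needs.\<close>

lemma psum_le_closed:
  assumes "\<mu> \<in> U" "U \<subseteq> exponents n" and la: "\<kappa> \<in> exponents n" and "psum_le n \<mu> \<kappa>"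
    and add: "\<And>\<alpha> i. \<alpha> \<in> U \<Longrightarrow> i \<in> {1..n} \<Longrightarrow>
      (\<kappa> \<in> partitions n \<Longrightarrow> \<alpha> \<in> partitions n \<Longrightarrow> \<alpha> + sg i 1 \<in> partitions n) \<Longrightarrow> \<alpha> + sg i 1 \<in> U"
    and shift: "\<And>\<alpha> i j. \<alpha> \<in> U \<Longrightarrow> 1 \<le> i \<Longrightarrow> i < j \<Longrightarrow> j \<le> n \<Longrightarrow> lk \<alpha> j \<noteq> 0 \<Longrightarrow>
      (\<kappa> \<in> partitions n \<Longrightarrow> lk \<alpha> i < lk \<alpha> j) \<Longrightarrow>
      (\<kappa> \<in> partitions n \<Longrightarrow> \<alpha> \<in> partitions n \<Longrightarrow> shift \<alpha> i j \<in> partitions n) \<Longrightarrow> shift \<alpha> i j \<in> U"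
  shows "\<kappa> \<in> U"
  using assms(1,4)
proof (induction "(\<Sum>k\<le>n. psum \<kappa> k) - (\<Sum>k\<le>n. psum \<mu> k)" arbitrary: \<mu> rule: less_induct)
  case less
  have mu: "\<mu> \<in> exponents n" using less.prems assms(2) by blast
  have IH: "\<kappa> \<in> U" if \<nu>: "\<nu> \<in> U" "psum_le n \<nu> \<kappa>" "psum_le n \<mu> \<nu>" "\<mu> \<noteq> \<nu>" for \<nu>
  proof (rule less.hyps)
    have "(\<Sum>k\<le>n. psum \<mu> k) < (\<Sum>k\<le>n. psum \<nu> k)"
      using mu \<nu> assms(2) by (intro psum_le_sum_less) auto
    \<comment> \<open>This upper bound is what makes the truncated difference drop strictly.\<close>
    moreover have "(\<Sum>k\<le>n. psum \<nu> k) \<le> (\<Sum>k\<le>n. psum \<kappa> k)"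
      using \<nu>(2) by (intro sum_mono) (simp add: psum_le_def)
    ultimately show "(\<Sum>k\<le>n. psum \<kappa> k) - (\<Sum>k\<le>n. psum \<nu> k) < (\<Sum>k\<le>n. psum \<kappa> k) - (\<Sum>k\<le>n. psum \<mu> k)"
      by linarith
  qed (use \<nu> in auto)
  show ?case
  proof (cases "\<mu> = \<kappa>")
    case False
    show ?thesis
    proof (cases rule: psum_le_step[OF mu la less.prems(2) False, case_names add shift])
      case (add i)
      have "lk \<mu> i \<noteq> lk (\<mu> + sg i 1) i" by (simp add: lookup_add)
      then have "\<mu> \<noteq> \<mu> + sg i 1" by metis
      then show ?thesis
        using add less.prems by (intro IH[of "\<mu> + sg i 1"] assms(5)) (auto intro: psum_le_add)
    next
      case (shift i j)
      have "lk \<mu> i \<noteq> lk (shift \<mu> i j) i" using shift by (simp add: lookup_shift)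
      then have "\<mu> \<noteq> shift \<mu> i j" by metis
      moreover have "psum_le n \<mu> (shift \<mu> i j)"
        using shift by (simp add: psum_le_def psum_shift)
      ultimately show ?thesis
        using shift less.prems by (intro IH[of "shift \<mu> i j"] assms(6)) auto
    qed
  qed (use less.prems in simp)
qed

section \<open>Strongly stable ideals as up-sets\<close>

lemma psum_upset_subset: "psum_upset n B \<subseteq> exponents n"
  by (auto simp: psum_upset_def)

lemma psum_upset_superset: "B \<subseteq> exponents n \<Longrightarrow> B \<subseteq> psum_upset n B"
  by (auto simp: psum_upset_def intro: psum_le_refl)

lemma psum_upset_mono: "A \<subseteq> B \<Longrightarrow> psum_upset n A \<subseteq> psum_upset n B"
  by (auto simp: psum_upset_def)

lemma psum_upset_idem [simp]: "psum_upset n (psum_upset n B) = psum_upset n B"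
proof
  show "psum_upset n (psum_upset n B) \<subseteq> psum_upset n B"
    by (auto simp: psum_upset_def dest: psum_le_trans)
qed (intro psum_upset_superset psum_upset_subset)

lemma psum_upset_mult_closed:
  assumes "psum_upset n S = S"
  shows "mult_closed n S"
proof -
  have "a + d \<in> psum_upset n S" if "a \<in> S" "d \<in> exponents n" for a d
    using that psum_upset_subset[of n S] assms by (auto simp: psum_upset_def intro!: exponents_add psum_le_add)
  then show ?thesis using assms psum_upset_subset[of n S] by (simp add: mult_closed_def)
qed

text \<open>Multiplication by a variable and the Borel moves both raise prefix sums, and by
  \<open>psum_le_closed\<close> they reach every larger vector.\<close>

lemma strongly_stable_mspan_iff:
  "strongly_stable n (mspan S :: 'k::field mpol set) \<longleftrightarrow> psum_upset n S = S"
proof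
  assume st: "strongly_stable n (mspan S :: 'k mpol set)"
  then have mc: "mult_closed n S" by (simp add: strongly_stable_def)
  then have S: "S \<subseteq> exponents n" by (simp add: mult_closed_def)
  have "\<kappa> \<in> S" if "\<mu> \<in> S" "\<kappa> \<in> exponents n" "psum_le n \<mu> \<kappa>" for \<mu> \<kappa>
    using that(1) S that(2,3)
  proof (rule psum_le_closed)
    fix \<alpha> i assume "\<alpha> \<in> S" "i \<in> {1..n}"
    then show "\<alpha> + sg i 1 \<in> S" using mc exponents_single by (simp add: mult_closed_def)
  next
    fix \<alpha> i j assume "\<alpha> \<in> S" "1 \<le> i" "i < j" "j \<le> n" "lk \<alpha> j \<noteq> 0"
    then show "shift \<alpha> i j \<in> S" using st S by (auto simp: strongly_stable_def)
  qed
  then show "psum_upset n S = S" using psum_upset_superset[OF S] by (auto simp: psum_upset_def)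
next
  assume eq: "psum_upset n S = S"
  have "shift \<alpha> i j \<in> psum_upset n S"
    if "\<alpha> \<in> S" "\<alpha> \<in> exponents n" "1 \<le> i" "i < j" "j \<le> n" "lk \<alpha> j \<noteq> 0" for \<alpha> i j
  proof -
    have "psum_le n \<alpha> (shift \<alpha> i j)" using that by (simp add: psum_le_def psum_shift)
    moreover have "shift \<alpha> i j \<in> exponents n" using that by (intro exponents_shift) auto
    ultimately show ?thesis using that by (auto simp: psum_upset_def)
  qed
  then show "strongly_stable n (mspan S :: 'k mpol set)"
    by (auto simp: strongly_stable_def psum_upset_mult_closed eq)
qed

lemma strongly_stable_imp_psum_upset:
  assumes "strongly_stable n (J :: 'k::field mpol set)"
  obtains S where "J = mspan S" "psum_upset n S = S"
  using assms strongly_stable_mspan_iff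
  by (metis monomial_ideal_iff strongly_stable_def)

text \<open>The up-set generated by \<open>B\<close> is the smallest one containing
  \<open>B\<close>, so the \<open>LEAST\<close> in \<open>Borel\<close> is attained.\<close>

lemma Borel_xpow:
  assumes "B \<subseteq> exponents n"
  shows "Borel n (xpow ` B) = (mspan (psum_upset n B) :: 'k::field mpol set)"
  unfolding Borel_def
proof (rule Least_equality)
  show "strongly_stable n (mspan (psum_upset n B) :: 'k mpol set) \<and> xpow ` B \<subseteq> (mspan (psum_upset n B) :: 'k mpol set)"
    using psum_upset_superset[OF assms] by (auto simp: strongly_stable_mspan_iff)
next
  fix J :: "'k mpol set" assume J: "strongly_stable n J \<and> xpow ` B \<subseteq> J"
  then obtain S where S: "J = mspan S" "psum_upset n S = S" using strongly_stable_imp_psum_upset by blast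
  then have "B \<subseteq> S" using J by auto
  then show "mspan (psum_upset n B) \<subseteq> J" using S psum_upset_mono[of B S n] by simp
qed

section \<open>Sorting, and partitions as the least rearrangements\<close>

text \<open>A permutation maximizing \<open>\<Sum>\<^sub>i i f(\<sigma>(i))\<close> sorts \<open>f\<close>: undoing an inversion increases the sum.\<close>

lemma exists_sorting_permutation:
  fixes f :: "nat \<Rightarrow> nat"
  obtains \<sigma> where "\<sigma> permutes {1..n}"
    "\<And>i j. 1 \<le> i \<Longrightarrow> i < j \<Longrightarrow> j \<le> n \<Longrightarrow> f (\<sigma> i) \<le> f (\<sigma> j)"
proof -
  define F where "F \<sigma> = (\<Sum>i=1..n. i * f (\<sigma> i))" for \<sigma>
  define S where "S = {\<sigma>. \<sigma> permutes {1..n}}"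
  have "finite S" by (simp add: S_def finite_permutations)
  moreover have "S \<noteq> {}" using permutes_id[of "{1..n}"] unfolding S_def by blast
  ultimately have "Max (F ` S) \<in> F ` S" "\<And>\<tau>. \<tau> \<in> S \<Longrightarrow> F \<tau> \<le> Max (F ` S)" by auto
  then obtain \<sigma> where \<sigma>: "\<sigma> \<in> S" "\<And>\<tau>. \<tau> \<in> S \<Longrightarrow> F \<tau> \<le> F \<sigma>" by auto
  show thesis
  proof (rule that)
    show "\<sigma> permutes {1..n}" using \<sigma> by (simp add: S_def)
    fix i j assume ij: "1 \<le> i" "i < j" "j \<le> n"
    define \<tau> where "\<tau> = \<sigma> \<circ> transpose i j"
    have split: "F \<rho> = j * f (\<rho> j) + (i * f (\<rho> i) + (\<Sum>k\<in>{1..n} - {j} - {i}. k * f (\<rho> k)))" for \<rho>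
      unfolding F_def using ij by (subst sum.remove[of _ j]) (auto simp: sum.remove[of _ i])
    have "(\<Sum>k\<in>{1..n} - {j} - {i}. k * f (\<tau> k)) = (\<Sum>k\<in>{1..n} - {j} - {i}. k * f (\<sigma> k))"
      by (intro sum.cong refl) (auto simp: \<tau>_def transpose_def)
    moreover have "\<tau> \<in> S" using \<sigma> ij unfolding \<tau>_def S_def
      by (auto intro!: permutes_compose permutes_swap_id)
    ultimately have le: "j * f (\<sigma> i) + i * f (\<sigma> j) \<le> j * f (\<sigma> j) + i * f (\<sigma> i)"
      using \<sigma>(2)[of \<tau>] split[of \<tau>] split[of \<sigma>] by (simp add: \<tau>_def)
    show "f (\<sigma> i) \<le> f (\<sigma> j)"
    proof (rule ccontr)
      assume "\<not> f (\<sigma> i) \<le> f (\<sigma> j)"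
      \<comment> \<open>With both differences written as successors, \<open>le\<close> reduces to
        \<open>Suc d * Suc e \<le> 0\<close>.\<close>
      then obtain e where e: "f (\<sigma> i) = f (\<sigma> j) + Suc e"
        using less_imp_Suc_add[of "f (\<sigma> j)" "f (\<sigma> i)"] by auto
      obtain d where d: "j = i + Suc d" using less_imp_Suc_add[OF ij(2)] by auto
      show False using le unfolding e d by (simp add: algebra_simps)
    qed
  qed
qed

lemma exists_sorted_rearrangement:
  assumes "\<alpha> \<in> exponents n"
  obtains \<sigma> where "\<sigma> permutes {1..n}" "permute_exp \<sigma> \<alpha> \<in> partitions n"
proof -
  obtain \<sigma> where \<sigma>: "\<sigma> permutes {1..n}"
    "\<And>i j. 1 \<le> i \<Longrightarrow> i < j \<Longrightarrow> j \<le> n \<Longrightarrow> lk \<alpha> (\<sigma> i) \<le> lk \<alpha> (\<sigma> j)"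
    using exists_sorting_permutation[where f = "lk \<alpha>" and n = n] by blast
  then have "permute_exp \<sigma> \<alpha> \<in> partitions n"
    using permute_exp_in_exponents[OF \<sigma>(1) assms] by (simp add: partitions_def lookup_permute_exp)
  then show thesis using that \<sigma>(1) by blast
qed

text \<open>The first \<open>k\<close> entries of a nondecreasing vector are its \<open>k\<close>
  smallest. The sets \<open>C - A\<close> and \<open>A - C\<close> have equal size, and
  \<open>\<kappa>\<^sub>k\<close> bounds the entries on the first from above and those on the second
  from below.\<close>

lemma partition_psum_le:
  assumes la: "\<kappa> \<in> partitions n" and A: "A \<subseteq> {1..n}"
  shows "psum \<kappa> (card A) \<le> (\<Sum>i\<in>A. lk \<kappa> i)"
proof -
  define k where "k = card A"
  define C where "C = {1..k}"
  have fin: "finite A" using A finite_subset by blast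
  have kn: "k \<le> n" using card_mono[OF _ A] by (simp add: k_def)
  have c: "card (C - A) = card (A - C)"
    using fin card_Diff_subset_Int[of C A] card_Diff_subset_Int[of A C]
    by (simp add: C_def k_def Int_commute)
  have "(\<Sum>i\<in>C - A. lk \<kappa> i) \<le> of_nat (card (C - A)) * lk \<kappa> k"
    using kn by (intro sum_bounded_above partitions_mono[OF la]) (auto simp: C_def)
  also have "\<dots> \<le> (\<Sum>i\<in>A - C. lk \<kappa> i)"
  \<comment> \<open>For \<open>k = 0\<close> there is no coordinate to act as the threshold, but
    \<open>C\<close> is empty and the left side vanishes.\<close>
  proof (cases "k = 0")
    case True
    then show ?thesis by (simp add: C_def)
  next
    case False
    then show ?thesis unfolding c
      using A by (intro sum_bounded_below partitions_mono[OF la]) (auto simp: C_def subset_iff)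
  qed
  finally have le: "(\<Sum>i\<in>C - A. lk \<kappa> i) \<le> (\<Sum>i\<in>A - C. lk \<kappa> i)" .
  have "psum \<kappa> k = (\<Sum>i\<in>C - A. lk \<kappa> i) + (\<Sum>i\<in>C \<inter> A. lk \<kappa> i)"
    using sum.Int_Diff[of C "lk \<kappa>" A] by (simp add: psum_def C_def)
  moreover have "(\<Sum>i\<in>A. lk \<kappa> i) = (\<Sum>i\<in>A - C. lk \<kappa> i) + (\<Sum>i\<in>C \<inter> A. lk \<kappa> i)"
    using sum.Int_Diff[OF fin, of "lk \<kappa>" C] by (simp add: Int_commute)
  ultimately show ?thesis using le by (simp add: k_def)
qed

lemma psum_permute_exp:
  assumes "\<sigma> permutes {1..n}"
  shows "psum (permute_exp \<sigma> \<alpha>) k = (\<Sum>i\<in>\<sigma> ` {1..k}. lk \<alpha> i)"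
  using permutes_inj_on[OF assms] by (simp add: psum_def lookup_permute_exp[OF assms] sum.reindex)

text \<open>A prefix sum of a rearrangement is a sum over the image of the prefix, so bounds over
  all sets of positions handle all permutations at once.\<close>

lemma psum_le_permute_expI:
  assumes \<sigma>: "\<sigma> permutes {1..n}"
    and A: "\<And>A. A \<subseteq> {1..n} \<Longrightarrow> psum \<kappa> (card A) \<le> (\<Sum>i\<in>A. lk \<mu> i)"
  shows "psum_le n \<kappa> (permute_exp \<sigma> \<mu>)"
  unfolding psum_le_def
proof (intro allI impI)
  fix k assume "k \<le> n"
  then have "\<sigma> ` {1..k} \<subseteq> {1..n}"
    using permutes_image[OF \<sigma>] by (metis image_mono atLeastatMost_subset_iff le_refl)
  moreover have "card (\<sigma> ` {1..k}) = k" using permutes_inj_on[OF \<sigma>] by (simp add: card_image)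
  ultimately show "psum \<kappa> k \<le> psum (permute_exp \<sigma> \<mu>) k"
    using A[of "\<sigma> ` {1..k}"] by (simp add: psum_permute_exp[OF \<sigma>])
qed

lemma psum_le_permute_exp:
  assumes "\<kappa> \<in> partitions n" "\<sigma> permutes {1..n}"
  shows "psum_le n \<kappa> (permute_exp \<sigma> \<kappa>)"
  using assms by (intro psum_le_permute_expI partition_psum_le)

text \<open>A shifted partition may be unsorted, and the symmetric core asks for all its
  rearrangements. The strict inequality of the two entries keeps each of them above
  \<open>\<kappa>\<close>.\<close>

lemma psum_le_permute_exp_shift:
  assumes la: "\<kappa> \<in> partitions n" and \<sigma>: "\<sigma> permutes {1..n}"
    and ij: "1 \<le> i" "i < j" "j \<le> n" "lk \<kappa> i < lk \<kappa> j"
  shows "psum_le n \<kappa> (permute_exp \<sigma> (shift \<kappa> i j))"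
  using \<sigma>
proof (rule psum_le_permute_expI)
  fix A assume A: "A \<subseteq> {1..n}"
  then have fin: "finite A" using finite_subset by blast
  have single: "(\<Sum>m\<in>A. lk (sg l 1) m) = (if l \<in> A then 1 else (0::nat))" for l
    using fin by (simp add: lookup_single when_def)
  have "shift \<kappa> i j + sg j 1 = \<kappa> + sg i 1" using ij by (intro shift_add_single) auto
  then have "(\<Sum>m\<in>A. lk (shift \<kappa> i j + sg j 1) m) = (\<Sum>m\<in>A. lk (\<kappa> + sg i 1) m)" by simp
  then have eq: "(\<Sum>m\<in>A. lk (shift \<kappa> i j) m) + (if j \<in> A then 1 else 0) =
      (\<Sum>m\<in>A. lk \<kappa> m) + (if i \<in> A then 1 else 0)"
    by (simp only: lookup_add sum.distrib single)
  show "psum \<kappa> (card A) \<le> (\<Sum>m\<in>A. lk (shift \<kappa> i j) m)"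
  proof (cases "j \<in> A \<and> i \<notin> A")
    case True
    \<comment> \<open>Only here does the shift lower the sum over \<open>A\<close>, namely by one.
      Exchanging \<open>j\<close> for \<open>i\<close> keeps the size of the set and lowers the sum
      of \<open>\<kappa>\<close> by at least one, so the bound for the new set absorbs the
      loss.\<close>
    let ?A = "insert i (A - {j})"
    have "card A = Suc (card (A - {j}))" using True fin by (intro card.remove) auto
    also have "\<dots> = card ?A" using True fin by (intro card_insert_disjoint[symmetric]) auto
    finally have "card ?A = card A" by simp
    moreover have "psum \<kappa> (card ?A) \<le> (\<Sum>m\<in>?A. lk \<kappa> m)"
      using A ij by (intro partition_psum_le[OF la]) auto
    moreover have "(\<Sum>m\<in>?A. lk \<kappa> m) = lk \<kappa> i + (\<Sum>m\<in>A - {j}. lk \<kappa> m)"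
      using True fin by simp
    moreover have "(\<Sum>m\<in>A. lk \<kappa> m) = lk \<kappa> j + (\<Sum>m\<in>A - {j}. lk \<kappa> m)"
      using True fin by (intro sum.remove) auto
    ultimately show ?thesis using eq True ij by simp
  next
    case False
    then show ?thesis using eq partition_psum_le[OF la A] by (auto split: if_splits)
  qed
qed

section \<open>Symmetric strongly shifted ideals as symmetric cores of up-sets\<close>

text \<open>A partition is below all its rearrangements, so an up-set containing it contains them
  too. This yields the description of \<open>parts n (sym_inter n J)\<close>.\<close>

lemma sym_core_partitions:
  assumes "psum_upset n S = S" "\<kappa> \<in> partitions n"
  shows "\<kappa> \<in> sym_core n S \<longleftrightarrow> \<kappa> \<in> S"
proof
  assume "\<kappa> \<in> S"
  then have "permute_exp \<sigma> \<kappa> \<in> psum_upset n S" if "\<sigma> permutes {1..n}" for \<sigma>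
    using psum_le_permute_exp[OF assms(2) that] permute_exp_in_exponents[OF that] assms(2)
    by (auto simp: psum_upset_def partitions_exponents)
  then show "\<kappa> \<in> sym_core n S" by (simp add: sym_core_def assms(1))
qed (use sym_core_subset in blast)

lemma permute_exp_add:
  "\<sigma> permutes {1..n} \<Longrightarrow> permute_exp \<sigma> (\<alpha> + \<beta>) = permute_exp \<sigma> \<alpha> + permute_exp \<sigma> \<beta>"
  by (rule poly_mapping_eqI) (simp add: lookup_permute_exp lookup_add)

lemma sym_core_mult_closed:
  assumes "mult_closed n S"
  shows "mult_closed n (sym_core n S)"
  using assms sym_core_subset[of n S] permute_exp_in_exponents
  by (auto simp: mult_closed_def sym_core_def permute_exp_add)

lemma parts_mspan: "parts n (mspan S :: 'k::field mpol set) = {\<kappa> \<in> partitions n. \<kappa> \<in> S}"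
  by (simp add: parts_def)

lemma sym_strongly_shifted_sym_core:
  assumes S: "psum_upset n S = S"
  shows "sym_strongly_shifted n (mspan (sym_core n S) :: 'k::field mpol set)"
proof -
  have "permute_exp \<sigma> \<alpha> \<in> sym_core n S" if "\<sigma> permutes {1..n}" "\<alpha> \<in> sym_core n S" for \<sigma> \<alpha>
    using that permutes_compose unfolding sym_core_def by (auto simp: permute_exp_comp)
  moreover have "shift \<kappa> i j \<in> sym_core n S"
    if "\<kappa> \<in> partitions n" "\<kappa> \<in> sym_core n S" "1 \<le> i" "i < j" "j \<le> n" "lk \<kappa> i < lk \<kappa> j" for \<kappa> i j
  proof -
    have "\<kappa> \<in> S" "shift \<kappa> i j \<in> exponents n"
      using that sym_core_subset[of n S] by (auto intro!: exponents_shift dest: partitions_exponents)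
    then have "permute_exp \<sigma> (shift \<kappa> i j) \<in> psum_upset n S" if "\<sigma> permutes {1..n}" for \<sigma>
      using psum_le_permute_exp_shift[of \<kappa> n \<sigma> i j] that \<open>\<kappa> \<in> partitions n\<close>
        \<open>1 \<le> i\<close> \<open>i < j\<close> \<open>j \<le> n\<close> \<open>lk \<kappa> i < lk \<kappa> j\<close> permute_exp_in_exponents
      by (auto simp: psum_upset_def)
    then show ?thesis by (simp add: sym_core_def S)
  qed
  ultimately show ?thesis
    by (auto simp: sym_strongly_shifted_def sym_fixed_mspan parts_mspan
        sym_core_mult_closed psum_upset_mult_closed S)
qed

text \<open>The shift condition is available only at partitions, so the climb takes place in
  \<open>T \<inter> partitions n\<close>. Since \<open>\<kappa>\<close> is a partition,
  \<open>psum_le_closed\<close> provides moves that stay there and satisfy the strict inequality of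
  entries.\<close>

lemma sym_strongly_shifted_psum_le:
  assumes sss: "sym_strongly_shifted n (mspan T :: 'k::field mpol set)"
    and mu: "\<mu> \<in> partitions n" "\<mu> \<in> T" and la: "\<kappa> \<in> partitions n" and dom: "psum_le n \<mu> \<kappa>"
  shows "\<kappa> \<in> T"
proof -
  have mc: "mult_closed n T" using sss by (simp add: sym_strongly_shifted_def)
  have "\<kappa> \<in> T \<inter> partitions n"
  proof (rule psum_le_closed[of \<mu> _ n])
    fix \<alpha> i assume "\<alpha> \<in> T \<inter> partitions n" "i \<in> {1..n}"
      "\<kappa> \<in> partitions n \<Longrightarrow> \<alpha> \<in> partitions n \<Longrightarrow> \<alpha> + sg i 1 \<in> partitions n"
    then show "\<alpha> + sg i 1 \<in> T \<inter> partitions n"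
      using mc la exponents_single by (simp add: mult_closed_def)
  next
    fix \<alpha> i j assume "\<alpha> \<in> T \<inter> partitions n" "1 \<le> i" "i < j" "j \<le> n"
      "\<kappa> \<in> partitions n \<Longrightarrow> lk \<alpha> i < lk \<alpha> j"
      "\<kappa> \<in> partitions n \<Longrightarrow> \<alpha> \<in> partitions n \<Longrightarrow> shift \<alpha> i j \<in> partitions n"
    then show "shift \<alpha> i j \<in> T \<inter> partitions n"
      using sss la by (simp add: sym_strongly_shifted_def parts_mspan)
  qed (use mu la dom in \<open>auto intro: partitions_exponents\<close>)
  then show ?thesis by simp
qed

text \<open>Sort the vector, climb to the sorted one from an element of \<open>B\<close> through
  partitions, and undo the sorting by symmetry of \<open>T\<close>. This is the minimality half of
  \<open>Sss_eq\<close>.\<close>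

lemma sym_core_psum_upset_subset:
  assumes sss: "sym_strongly_shifted n (mspan T :: 'k::field mpol set)"
    and B: "B \<subseteq> partitions n" "B \<subseteq> T"
  shows "sym_core n (psum_upset n B) \<subseteq> T"
proof
  fix \<alpha> assume a: "\<alpha> \<in> sym_core n (psum_upset n B)"
  then have "\<alpha> \<in> exponents n" using sym_core_subset psum_upset_subset by blast
  then obtain \<sigma> where \<sigma>: "\<sigma> permutes {1..n}" "permute_exp \<sigma> \<alpha> \<in> partitions n"
    by (rule exists_sorted_rearrangement)
  then have "permute_exp \<sigma> \<alpha> \<in> psum_upset n B" using a by (simp add: sym_core_def)
  then have "permute_exp \<sigma> \<alpha> \<in> T"
    using sym_strongly_shifted_psum_le[OF sss] B \<sigma>(2) by (auto simp: psum_upset_def)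
  then show "\<alpha> \<in> T"
    using sss permutes_inv[OF \<sigma>(1)] permute_exp_inv(2)[OF \<sigma>(1), of \<alpha>]
    by (metis sym_fixed_mspan sym_strongly_shifted_def)
qed

lemma Sss_eq:
  assumes "B \<subseteq> partitions n"
  shows "Sss n B = (mspan (sym_core n (psum_upset n B)) :: 'k::field mpol set)"
  unfolding Sss_def
proof (rule Least_equality)
  have "B \<subseteq> psum_upset n B" using assms partitions_exponents by (intro psum_upset_superset) blast
  then have "B \<subseteq> sym_core n (psum_upset n B)"
    using assms sym_core_partitions[of n "psum_upset n B"] by auto
  then show "sym_strongly_shifted n (mspan (sym_core n (psum_upset n B)) :: 'k mpol set) \<and>
      xpow ` B \<subseteq> (mspan (sym_core n (psum_upset n B)) :: 'k mpol set)"
    by (auto intro: sym_strongly_shifted_sym_core)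
next
  fix I :: "'k mpol set" assume I: "sym_strongly_shifted n I \<and> xpow ` B \<subseteq> I"
  then obtain T where T: "I = mspan T"
    by (auto simp: sym_strongly_shifted_def monomial_ideal_iff)
  then have "B \<subseteq> T" using I by auto
  then show "mspan (sym_core n (psum_upset n B)) \<subseteq> I"
    using sym_core_psum_upset_subset[of n T B, where 'k='k] I T assms by simp
qed

section \<open>Minimal elements and partition Borel generators\<close>

definition psum_minimal :: "nat \<Rightarrow> (nat \<Rightarrow>\<^sub>0 nat) set \<Rightarrow> (nat \<Rightarrow>\<^sub>0 nat) set" where
  "psum_minimal n U = {\<mu> \<in> U. \<forall>\<nu>\<in>U. psum_le n \<nu> \<mu> \<longrightarrow> \<nu> = \<mu>}"

text \<open>Every descent ends at a minimal element, because the total of the prefix sums drops at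
  each step.\<close>

lemma psum_upset_minimal:
  assumes U: "U \<subseteq> exponents n"
  shows "psum_upset n (psum_minimal n U) = psum_upset n U"
proof
  have "\<exists>\<nu>\<in>psum_minimal n U. psum_le n \<nu> \<mu>" if "\<mu> \<in> U" for \<mu>
    using that
  proof (induction "\<Sum>k\<le>n. psum \<mu> k" arbitrary: \<mu> rule: less_induct)
    case less
    show ?case
    proof (cases "\<mu> \<in> psum_minimal n U")
      case False
      then obtain \<nu> where \<nu>: "\<nu> \<in> U" "psum_le n \<nu> \<mu>" "\<nu> \<noteq> \<mu>"
        using less.prems by (auto simp: psum_minimal_def)
      then have "(\<Sum>k\<le>n. psum \<nu> k) < (\<Sum>k\<le>n. psum \<mu> k)"
        using U less.prems by (intro psum_le_sum_less) auto
      from less.hyps[OF this \<nu>(1)] show ?thesis using \<nu>(2) psum_le_trans by blast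
    qed (use psum_le_refl in blast)
  qed
  then show "psum_upset n U \<subseteq> psum_upset n (psum_minimal n U)"
    by (auto simp: psum_upset_def intro: psum_le_trans)
qed (auto intro!: psum_upset_mono simp: psum_minimal_def)

text \<open>The ideal is recovered from its partitions alone: each of its vectors is a rearrangement
  of one of them and hence lies above it.\<close>

lemma sym_strongly_shifted_eq_core:
  assumes sss: "sym_strongly_shifted n (mspan T :: 'k::field mpol set)"
  shows "sym_core n (psum_upset n (T \<inter> partitions n)) = T"
proof
  show "sym_core n (psum_upset n (T \<inter> partitions n)) \<subseteq> T"
    by (rule sym_core_psum_upset_subset[OF sss]) auto
  have fixed: "permute_exp \<sigma> \<alpha> \<in> T" if "\<sigma> permutes {1..n}" "\<alpha> \<in> T" for \<sigma> \<alpha>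
    using sss that by (simp add: sym_strongly_shifted_def sym_fixed_mspan)
  have T: "T \<subseteq> exponents n" using sss by (simp add: sym_strongly_shifted_def mult_closed_def)
  show "T \<subseteq> sym_core n (psum_upset n (T \<inter> partitions n))"
  proof
    fix \<alpha> assume a: "\<alpha> \<in> T"
    then obtain \<sigma> where \<sigma>: "\<sigma> permutes {1..n}" "permute_exp \<sigma> \<alpha> \<in> partitions n"
      using T exists_sorted_rearrangement by blast
    have "permute_exp \<tau> \<alpha> \<in> psum_upset n (T \<inter> partitions n)" if \<tau>: "\<tau> permutes {1..n}" for \<tau>
    proof -
      \<comment> \<open>Undoing the sorting and then applying \<open>\<tau>\<close> presents
        \<open>permute_exp \<tau> \<alpha>\<close> as a rearrangement of the sorted vector.\<close>
      have "permute_exp (inv_into UNIV \<sigma> \<circ> \<tau>) (permute_exp \<sigma> \<alpha>) =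
          permute_exp \<tau> (permute_exp (inv_into UNIV \<sigma>) (permute_exp \<sigma> \<alpha>))"
        using \<sigma>(1) \<tau> by (intro permute_exp_comp[symmetric]) (auto intro: permutes_inv)
      then have "psum_le n (permute_exp \<sigma> \<alpha>) (permute_exp \<tau> \<alpha>)"
        using psum_le_permute_exp[OF \<sigma>(2) permutes_compose[OF \<tau> permutes_inv[OF \<sigma>(1)]]]
        by (simp add: permute_exp_inv(2)[OF \<sigma>(1)])
      moreover have "permute_exp \<sigma> \<alpha> \<in> T \<inter> partitions n" using fixed[OF \<sigma>(1) a] \<sigma>(2) by simp
      moreover have "permute_exp \<tau> \<alpha> \<in> exponents n" using fixed[OF \<tau> a] T by blast
      ultimately show ?thesis by (auto simp: psum_upset_def)
    qed
    then show "\<alpha> \<in> sym_core n (psum_upset n (T \<inter> partitions n))" by (simp add: sym_core_def)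
  qed
qed

text \<open>The minimal partitions generate. Conversely, a minimal partition lies above some element
  of any generating set \<open>B\<close>; that element is itself a partition in \<open>T\<close>, so
  minimality makes the two equal.\<close>

lemma borel_gens_eq:
  assumes sss: "sym_strongly_shifted n (mspan T :: 'k::field mpol set)"
  shows "borel_gens n (mspan T :: 'k mpol set) = psum_minimal n (T \<inter> partitions n)"
  unfolding borel_gens_def
proof (rule Least_equality)
  have U: "T \<inter> partitions n \<subseteq> exponents n" "psum_minimal n (T \<inter> partitions n) \<subseteq> partitions n"
    using partitions_exponents by (auto simp: psum_minimal_def)
  then show "psum_minimal n (T \<inter> partitions n) \<subseteq> partitions n \<and>
      (mspan T :: 'k mpol set) = Sss n (psum_minimal n (T \<inter> partitions n))"
    by (simp add: Sss_eq psum_upset_minimal sym_strongly_shifted_eq_core[OF sss])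
next
  fix B assume "B \<subseteq> partitions n \<and> (mspan T :: 'k mpol set) = Sss n B"
  then have B: "B \<subseteq> partitions n" and T: "T = sym_core n (psum_upset n B)" by (auto simp: Sss_eq)
  have Bd: "B \<subseteq> psum_upset n B" using B partitions_exponents by (intro psum_upset_superset) blast
  show "psum_minimal n (T \<inter> partitions n) \<subseteq> B"
  proof
    fix \<mu> assume mu: "\<mu> \<in> psum_minimal n (T \<inter> partitions n)"
    then have "\<mu> \<in> psum_upset n B" using T sym_core_subset by (auto simp: psum_minimal_def)
    then obtain \<nu> where \<nu>: "\<nu> \<in> B" "psum_le n \<nu> \<mu>" by (auto simp: psum_upset_def)
    then have "\<nu> \<in> T \<inter> partitions n"
      using B Bd sym_core_partitions[of n "psum_upset n B"] by (auto simp: T)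
    then show "\<mu> \<in> B" using mu \<nu> by (auto simp: psum_minimal_def)
  qed
qed

section \<open>Passing between strongly stable and symmetric strongly shifted ideals\<close>

lemma sym_inter_strongly_stable:
  fixes J :: "'k::field mpol set"
  assumes J: "strongly_stable n J" "proper_ideal n J"
  shows "sym_strongly_shifted n (sym_inter n J)" "proper_ideal n (sym_inter n J)"
    "parts n (sym_inter n J) = {\<kappa> \<in> partitions n. xpow \<kappa> \<in> J}"
proof -
  obtain S where S: "J = mspan S" "psum_upset n S = S" using J strongly_stable_imp_psum_upset by blast
  show "sym_strongly_shifted n (sym_inter n J)"
    using sym_strongly_shifted_sym_core[OF S(2)] by (simp add: S(1) sym_inter_mspan)
  show "proper_ideal n (sym_inter n J)"
    using J(2) sym_core_subset[of n S] psum_upset_mult_closed[OF S(2)] sym_core_mult_closed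
    by (auto simp: S(1) sym_inter_mspan proper_ideal_mspan)
  show "parts n (sym_inter n J) = {\<kappa> \<in> partitions n. xpow \<kappa> \<in> J}"
    using sym_core_partitions[OF S(2)] by (auto simp: S(1) sym_inter_mspan parts_mspan)
qed

text \<open>The generators are the minimal partitions of \<open>I\<close>, so \<open>J\<close> is
  coded by the up-set of all its partitions. Any competing \<open>J'\<close> contains
  \<open>I\<close>, hence these partitions and the up-set above them.\<close>

lemma Borel_borel_gens:
  fixes I :: "'k::field mpol set"
  assumes I: "sym_strongly_shifted n I" "proper_ideal n I"
  defines "J \<equiv> Borel n (xpow ` borel_gens n I) :: 'k mpol set"
  shows "strongly_stable n J" "proper_ideal n J" "I = sym_inter n J"
    "\<And>J'. strongly_stable n J' \<Longrightarrow> proper_ideal n J' \<Longrightarrow> I = sym_inter n J' \<Longrightarrow> J \<subseteq> J'"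
proof -
  obtain T where T: "I = mspan T" "mult_closed n T"
    using I(1) by (auto simp: sym_strongly_shifted_def monomial_ideal_iff)
  let ?U = "T \<inter> partitions n"
  have U: "?U \<subseteq> exponents n" "psum_minimal n ?U \<subseteq> exponents n" "psum_minimal n ?U \<subseteq> ?U"
    using partitions_exponents by (auto simp: psum_minimal_def)
  have gens: "borel_gens n I = psum_minimal n ?U"
    using I(1) borel_gens_eq unfolding T(1) by blast
  have J: "J = mspan (psum_upset n ?U)"
    by (simp add: J_def gens Borel_xpow[OF U(2)] psum_upset_minimal[OF U(1)])
  show "strongly_stable n J" by (simp add: J strongly_stable_mspan_iff)
  have eq: "sym_core n (psum_upset n ?U) = T" using I(1) sym_strongly_shifted_eq_core unfolding T(1) by blast
  then show "I = sym_inter n J" by (simp add: J sym_inter_mspan T(1))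
  \<comment> \<open>The zero vector is a partition, so it lies in the up-set exactly when it lies in
    the core \<open>T\<close>; properness passes from \<open>I\<close> to \<open>J\<close>.\<close>
  have "0 \<in> partitions n" by (simp add: partitions_def)
  then have "0 \<in> psum_upset n ?U \<longleftrightarrow> 0 \<in> T"
    using sym_core_partitions[of n "psum_upset n ?U" 0] eq by simp
  then show "proper_ideal n J"
    using I(2) by (simp add: J T proper_ideal_mspan psum_upset_mult_closed)
  fix J' :: "'k mpol set"
  assume J': "strongly_stable n J'" "proper_ideal n J'" "I = sym_inter n J'"
  then obtain S where S: "J' = mspan S" "psum_upset n S = S" using strongly_stable_imp_psum_upset by blast
  then have "T = sym_core n S" using J'(3) T(1) by (simp add: sym_inter_mspan)
  then have "?U \<subseteq> S" using sym_core_subset by blast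
  then show "J \<subseteq> J'" using S psum_upset_mono[of ?U S n] by (simp add: J)
qed

theorem theorem3p8:
  fixes n :: nat
  shows
    "(\<forall>J :: 'k::field mpol set. strongly_stable n J \<and> proper_ideal n J \<longrightarrow>
        (let I = sym_inter n J in
          sym_strongly_shifted n I \<and> proper_ideal n I \<and>
          parts n I = {l \<in> partitions n. xpow l \<in> J})) \<and>
     (\<forall>I :: 'k mpol set. sym_strongly_shifted n I \<and> proper_ideal n I \<longrightarrow>
        (\<exists>J. strongly_stable n J \<and> proper_ideal n J \<and> I = sym_inter n J) \<and>
        (let J = Borel n (xpow ` borel_gens n I) in
          strongly_stable n J \<and> proper_ideal n J \<and> I = sym_inter n J \<and>
          (\<forall>J'. strongly_stable n J' \<and> proper_ideal n J' \<and> I = sym_inter n J' \<longrightarrow> J \<subseteq> J')))"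
proof (intro conjI allI impI, goal_cases)
  case (1 J)
  then show ?case using sym_inter_strongly_stable[of n J] unfolding Let_def by blast
next
  case (2 I)
  then show ?case using Borel_borel_gens(1-3)[of n I] by blast
next
  case (3 I)
  then show ?case using Borel_borel_gens[of n I] unfolding Let_def by blast
qed

end
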